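(* The discrete Maxwell's equations are multisymplectic, in the following sense. Let $\mathcal{K}$ be an oriented $4$-dimensional discrete spacetime mesh, let $\mathcal{J}$ be a given dual discrete $3$-form, and let $K\subset\mathcal{K}$ be an arbitrary (finite, $4$-dimensional) subcomplex. Let $\mathcal{L}_d=-\frac12\mathrm{d}A\wedge*\mathrm{d}A+A\wedge\mathcal{J}$ be the discrete Lagrangian, with discrete Euler--Lagrange equations $\mathrm{d}{*\mathrm{d}A}=\mathcal{J}$. Define the Cartan form $\theta_{\mathcal{L}_d}$, a smooth $1$-form on the space of discrete $1$-forms $A$ with values in discrete $3$-forms on the boundary, by $$\theta_{\mathcal{L}_d}\cdot\alpha=\alpha\wedge*\mathrm{d}A,$$ and the multisymplectic form $\omega_{\mathcal{L}_d}=-\mathbf{d}\theta_{\mathcal{L}_d}$, where $\mathbf{d}$ is the (smooth) exterior derivative on the space of discrete $1$-forms. Then the discrete multisymplectic form formula $$\langle\omega_{\mathcal{L}_d}\cdot\alpha\cdot\beta,\ \partial K\rangle=0$$ holds at every solution $A$ of the discrete Euler--Lagrange equations on $K$, for all first variations $\alpha,\beta$ of $A$ (variations tangent to the space of Euler--Lagrange solutions, not required to vanish on $\partial K$).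
   Context: Discrete exterior calculus (DEC) conventions, spacetime dimension $n=4$. Mesh: $K$ is a finite, oriented, manifold cell complex of dimension $4$ (for instance simplicial, rectangular, or prismal) in Lorentzian spacetime $\mathbb{R}^{3,1}$. Each primal $k$-cell $\sigma$ has a dual $(4-k)$-cell $*\sigma$ (by default circumcentric, restricted to $K$, i.e. truncated at $\partial K$). In addition, each $k$-cell $\sigma\subset\partial K$ has a $(3-k)$-dimensional boundary dual cell $*_\partial\sigma$, its dual within $\partial K$; these cells are part of $*K$, and $\partial( *K)=*(\partial K)$. The volumes of primal $2$-cells and their duals are nonzero. The causality sign $\kappa(\sigma)$ is $+1$ if $\sigma$ is spacelike and $-1$ otherwise. Discrete forms: a primal discrete $k$-form $\alpha$ assigns a real number $\langle\alpha,\sigma\rangle$ to each oriented primal $k$-cell, extended linearly to chains; dual forms do the same on the cells of $*K$ (including boundary dual cells). Exterior derivative: $\langle\mathrm{d}\alpha,\sigma\rangle=\langle\alpha,\partial\sigma\rangle$ on primal and dual meshes. Explicitly, for a dual $2$-form $\eta$ and an edge $e$ of $K$, $\langle\mathrm{d}\eta,*e\rangle=\sum_{\sigma^2\supset e}[\sigma^2:e]\langle\eta,*\sigma^2\rangle$, minus $\langle\eta,*_\partial e\rangle$ if $e\subset\partial K$, where $[\sigma^2:e]$ is the incidence number. Diagonal Hodge star: $\frac1{|*\sigma|}\langle*\alpha,*\sigma\rangle=\kappa(\sigma)\frac1{|\sigma|}\langle\alpha,\sigma\rangle$ for $2$-cells $\sigma$ of $K$. Pairings: for a primal $k$-form $\alpha$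 and a dual $(4-k)$-form $\eta$, $\langle\alpha\wedge\eta,K\rangle=\sum_{\sigma^k}\langle\alpha,\sigma^k\rangle\langle\eta,*\sigma^k\rangle$. For a primal $1$-form $\alpha$ and dual $2$-form $\eta$, $\langle\alpha\wedge\eta,\partial K\rangle=\sum_{e\subset\partial K}\langle\alpha,e\rangle\langle\eta,*_\partial e\rangle$. With these conventions discrete integration by parts reads $\langle\mathrm{d}\alpha\wedge\eta,K\rangle=\langle\alpha\wedge\mathrm{d}\eta,K\rangle+\langle\alpha\wedge\eta,\partial K\rangle$. Solutions and first variations: a solution $A$ of the discrete Euler--Lagrange equations on $K$ satisfies $\langle\mathrm{d}{*\mathrm{d}A},*e\rangle=\langle\mathcal{J},*e\rangle$ for every edge $e$ of $K$; for $e\subset\partial K$ this involves the value of the dual form $*\mathrm{d}A$ on the boundary dual cell $*_\partial e$ (a boundary flux value, which is thereby determined by $A$ and $\mathcal{J}$). A first variation $\alpha$ is a primal discrete $1$-form satisfying the linearized equations $\mathrm{d}{*\mathrm{d}\alpha}=0$ in the same sense (on $*e$ for every edge $e$ of $K$, with boundary values of $*\mathrm{d}\alpha$ understood in the same way). Explicitly, $\omega_{\mathcal{L}_d}\cdot\alpha\cdot\beta=\alpha\wedge*\mathrm{d}\beta-\beta\wedge*\mathrm{d}\alpha$. *)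

theory Defs
  imports "HOL-Analysis.Analysis"
begin

section \<open>Lorentzian linear algebra\<close>

text \<open>Points of \<open>\<real>\<^sup>3\<^sup>,\<^sup>1\<close> are vectors of type \<open>real ^ 4\<close>; the fourth coordinate is time.\<close>

type_synonym event = "real ^ 4"

definition mink :: "event \<Rightarrow> event \<Rightarrow> real" where
  "mink x y = x $ 1 * y $ 1 + x $ 2 * y $ 2 + x $ 3 * y $ 3 - x $ 4 * y $ 4"

text \<open>Leibniz determinant of a \<open>k \<times> k\<close> array; needed for all \<open>k \<le> 4\<close>, so that the size cannot be
  a type.\<close>

definition ndet :: "nat \<Rightarrow> (nat \<Rightarrow> nat \<Rightarrow> real) \<Rightarrow> real" where
  "ndet k a = (\<Sum>p | p permutes {..<k}. of_int (sign p) * (\<Prod>i<k. a i (p i)))"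


section \<open>Meshes\<close>

text \<open>Cells are (flat) convex polytopes, given as point sets.\<close>

type_synonym cell = "event set"

definition direction :: "cell \<Rightarrow> event set" where
  "direction \<sigma> = span {x - y | x y. x \<in> \<sigma> \<and> y \<in> \<sigma>}"

definition is_frame :: "cell \<Rightarrow> (nat \<Rightarrow> event) \<Rightarrow> bool" where
  "is_frame \<sigma> f \<longleftrightarrow> (let k = nat (aff_dim \<sigma>) in
     inj_on f {..<k} \<and> independent (f ` {..<k}) \<and> span (f ` {..<k}) = direction \<sigma>)"

text \<open>
  The cell \<open>\<sigma>\<close> is oriented by the ordered basis \<open>frame M \<sigma> 0, \<dots>, frame M \<sigma> (dim \<sigma> - 1)\<close> of its
  direction space (so vertices are positively oriented).

  Dual cells are the usual unions of elementary dual simplices spanned by the centres of a flag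
  \<open>\<sigma> \<subset> \<dots> \<subset> \<sigma>\<^sup>4\<close>.  The centres are circumcentres in the default (circumcentric) dual, but
  any choice of centres is allowed.  \<open>flag_sign\<close> gives the sign with which an elementary
  dual simplex enters the dual cell; it is identically 1 for well-centred meshes.
\<close>

record mesh =
  cells :: "cell set"
  frame :: "cell \<Rightarrow> nat \<Rightarrow> event"
  centre :: "cell \<Rightarrow> event"
  flag_sign :: "cell list \<Rightarrow> real"

text \<open>
  Incidence number \<open>[\<sigma>:\<tau>]\<close>, by the outward-vector-first convention; it is 0 unless \<open>\<tau>\<close> is a facet
  of \<open>\<sigma>\<close>.  The vector from an interior point of \<open>\<sigma>\<close> to a point of \<open>\<tau>\<close> points outward.  Two frames
  of the same space are equally oriented iff the determinant of their mutual Euclidean inner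
  products is positive, and this sign depends neither on the chosen points nor on the Euclidean
  inner product.
\<close>

definition incidence :: "mesh \<Rightarrow> cell \<Rightarrow> cell \<Rightarrow> real" where
  "incidence M \<sigma> \<tau> =
     (if \<tau> facet_of \<sigma>
      then let out = (SOME x. x \<in> \<tau>) - (SOME y. y \<in> rel_interior \<sigma>)
           in sgn (ndet (nat (aff_dim \<sigma>))
                (\<lambda>i j. case_nat out (frame M \<tau>) i \<bullet> frame M \<sigma> j))
      else 0)"

definition coherently_oriented :: "mesh \<Rightarrow> bool" where
  "coherently_oriented M \<longleftrightarrow>
     (\<forall>\<sigma>\<in>cells M. \<forall>\<rho>\<in>cells M. \<forall>\<tau>. aff_dim \<sigma> = 4 \<and> aff_dim \<rho> = 4 \<and> \<sigma> \<noteq> \<rho> \<and>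
        \<tau> facet_of \<sigma> \<and> \<tau> facet_of \<rho> \<longrightarrow> incidence M \<sigma> \<tau> = - incidence M \<rho> \<tau>)"

text \<open>Locally homeomorphic to a closed half-space of dimension 4.\<close>

definition manifold_with_boundary :: "event set \<Rightarrow> bool" where
  "manifold_with_boundary S \<longleftrightarrow>
     (\<forall>x\<in>S. \<exists>U (V :: event set). openin (top_of_set S) U \<and> x \<in> U \<and>
        openin (top_of_set {y. 0 \<le> y $ 1}) V \<and> U homeomorphic V)"

text \<open>Meshes may be infinite, but are locally finite.\<close>

definition spacetime_mesh :: "mesh \<Rightarrow> bool" where
  "spacetime_mesh M \<longleftrightarrow>
     (\<forall>\<sigma>\<in>cells M. polytope \<sigma> \<and> \<sigma> \<noteq> {}) \<and>
     (\<forall>\<sigma>\<in>cells M. \<forall>\<tau>. \<tau> face_of \<sigma> \<longrightarrow> \<tau> \<noteq> {} \<longrightarrow> \<tau> \<in> cells M) \<and>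
     (\<forall>\<sigma>\<in>cells M. \<forall>\<tau>\<in>cells M. (\<sigma> \<inter> \<tau>) face_of \<sigma> \<and> (\<sigma> \<inter> \<tau>) face_of \<tau>) \<and>
     (\<forall>\<sigma>\<in>cells M. \<exists>\<rho>\<in>cells M. aff_dim \<rho> = 4 \<and> \<sigma> face_of \<rho>) \<and>
     (\<forall>x\<in>\<Union>(cells M). \<exists>U. open U \<and> x \<in> U \<and> finite {\<sigma> \<in> cells M. \<sigma> \<inter> U \<noteq> {}}) \<and>
     manifold_with_boundary (\<Union>(cells M)) \<and>
     (\<forall>\<sigma>\<in>cells M. is_frame \<sigma> (frame M \<sigma>)) \<and>
     coherently_oriented M \<and>
     (\<forall>\<sigma>\<in>cells M. centre M \<sigma> \<in> affine hull \<sigma>) \<and>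
     (\<forall>fs. flag_sign M fs \<in> {1, -1})"

text \<open>A subcomplex inherits orientations and centres, so it is given by its set of cells.\<close>

definition finite_subcomplex :: "mesh \<Rightarrow> cell set \<Rightarrow> bool" where
  "finite_subcomplex M K \<longleftrightarrow>
     finite K \<and> K \<subseteq> cells M \<and>
     (\<forall>\<sigma>\<in>K. \<forall>\<tau>. \<tau> face_of \<sigma> \<longrightarrow> \<tau> \<noteq> {} \<longrightarrow> \<tau> \<in> K) \<and>
     (\<exists>\<sigma>\<in>K. aff_dim \<sigma> = 4)"

definition kcells :: "int \<Rightarrow> cell set \<Rightarrow> cell set" where
  "kcells k K = {\<sigma> \<in> K. aff_dim \<sigma> = k}"

text \<open>The cells of \<open>\<partial>K\<close>: all faces of those 3-cells that lie in exactly one 4-cell of \<open>K\<close>.\<close>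

definition bdry :: "cell set \<Rightarrow> cell set" where
  "bdry K = {\<rho> \<in> K. \<exists>\<tau>\<in>kcells 3 K. card {\<sigma> \<in> kcells 4 K. \<tau> facet_of \<sigma>} = 1 \<and> \<rho> face_of \<tau>}"


section \<open>Volumes and causality\<close>

text \<open>
  \<open>\<bar>\<sigma>\<bar>\<close>: the Lebesgue measure of \<open>\<sigma>\<close> in the affine coordinates given by its frame, times the
  Lorentzian volume of the parallelepiped spanned by the frame.  The product does not depend on
  the frame.
\<close>

definition vol :: "mesh \<Rightarrow> cell \<Rightarrow> real" where
  "vol M \<sigma> = (let k = nat (aff_dim \<sigma>); f = frame M \<sigma> in
     sqrt \<bar>ndet k (\<lambda>i j. mink (f i) (f j))\<bar> *
     measure (PiM {..<k} (\<lambda>_. lborel))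
       {t \<in> {..<k} \<rightarrow>\<^sub>E UNIV. (SOME p. p \<in> \<sigma>) + (\<Sum>i<k. t i *\<^sub>R f i) \<in> \<sigma>})"

definition simplex_vol :: "event list \<Rightarrow> real" where
  "simplex_vol ps = (let m = length ps - 1 in
     sqrt \<bar>ndet m (\<lambda>i j. mink (ps ! Suc i - ps ! 0) (ps ! Suc j - ps ! 0))\<bar> / fact m)"

definition flags :: "cell set \<Rightarrow> cell \<Rightarrow> cell list set" where
  "flags K \<sigma> = {fs. fs \<noteq> [] \<and> hd fs = \<sigma> \<and> set fs \<subseteq> K \<and> aff_dim (last fs) = 4 \<and>
     successively (\<lambda>\<tau> \<rho>. \<tau> facet_of \<rho>) fs}"

text \<open>
  \<open>\<bar>*\<sigma>\<bar>\<close> for the dual cell of \<open>\<sigma>\<close> in \<open>K\<close>.  Only flags inside \<open>K\<close> contribute: this is the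
  truncation of the dual cell at \<open>\<partial>K\<close>.
\<close>

definition dual_vol :: "mesh \<Rightarrow> cell set \<Rightarrow> cell \<Rightarrow> real" where
  "dual_vol M K \<sigma> = (\<Sum>fs\<in>flags K \<sigma>. flag_sign M fs * simplex_vol (map (centre M) fs))"

definition causality :: "cell \<Rightarrow> real" where
  "causality \<sigma> = (if \<forall>v\<in>direction \<sigma>. v \<noteq> 0 \<longrightarrow> mink v v > 0 then 1 else -1)"


section \<open>Discrete forms\<close>

text \<open>
  A discrete form is given by its values on cells with their chosen orientation; only the values
  on cells of the form's degree matter.  The dual mesh of \<open>K\<close> has a cell \<open>Dual \<sigma>\<close> (that is,
  \<open>*\<sigma>\<close>, truncated to \<open>K\<close>) for each \<open>\<sigma> \<in> K\<close> and a cell \<open>BDual \<sigma>\<close> (that is, \<open>*\<close> of \<open>\<sigma>\<close> taken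
  within \<open>\<partial>K\<close>) for each \<open>\<sigma> \<in> bdry K\<close>.
\<close>

datatype dual_cell = Dual cell | BDual cell

type_synonym primal_form = "cell \<Rightarrow> real"
type_synonym dual_form = "dual_cell \<Rightarrow> real"

definition extd :: "mesh \<Rightarrow> cell set \<Rightarrow> primal_form \<Rightarrow> primal_form" where
  "extd M K \<alpha> \<sigma> = (\<Sum>\<tau>\<in>K. incidence M \<sigma> \<tau> * \<alpha> \<tau>)"

text \<open>\<open>\<langle>d\<eta>, *e\<rangle> = \<langle>\<eta>, \<partial>(*e)\<rangle>\<close> for a dual 2-form \<open>\<eta>\<close> and an edge \<open>e\<close>.\<close>

definition dual_extd :: "mesh \<Rightarrow> cell set \<Rightarrow> dual_form \<Rightarrow> cell \<Rightarrow> real" where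
  "dual_extd M K \<eta> e = (\<Sum>\<sigma>\<in>K. incidence M \<sigma> e * \<eta> (Dual \<sigma>))
     - (if e \<in> bdry K then \<eta> (BDual e) else 0)"

text \<open>\<open>\<langle>\<alpha> \<and> \<eta>, K\<rangle>\<close> for a primal \<open>k\<close>-form and a dual \<open>(4 - k)\<close>-form.\<close>

definition pairing :: "int \<Rightarrow> cell set \<Rightarrow> primal_form \<Rightarrow> dual_form \<Rightarrow> real" where
  "pairing k K \<alpha> \<eta> = (\<Sum>\<sigma>\<in>kcells k K. \<alpha> \<sigma> * \<eta> (Dual \<sigma>))"

text \<open>
  Products \<open>\<alpha> \<and> \<eta>\<close> of a primal 1-form with a dual 2-form are discrete 3-forms on the boundary.
  They are supported on the 3-cells spanned by a boundary edge \<open>e\<close> and its boundary dual, hence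
  are functions of \<open>e\<close>.
\<close>

type_synonym bdry_form = "cell \<Rightarrow> real"

definition bdry_wedge :: "primal_form \<Rightarrow> dual_form \<Rightarrow> bdry_form" where
  "bdry_wedge \<alpha> \<eta> e = \<alpha> e * \<eta> (BDual e)"

definition bdry_integral :: "bdry_form \<Rightarrow> cell set \<Rightarrow> real" where
  "bdry_integral \<psi> K = (\<Sum>e\<in>kcells 1 (bdry K). \<psi> e)"

text \<open>
  The diagonal Hodge star determines a dual form on the cells \<open>Dual \<sigma>\<close> only; the values on the
  boundary dual cells are the extra argument \<open>b\<close>.
\<close>

definition hodge :: "mesh \<Rightarrow> cell set \<Rightarrow> primal_form \<Rightarrow> (cell \<Rightarrow> real) \<Rightarrow> dual_form" where
  "hodge M K \<alpha> b c = (case c of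
       Dual \<sigma> \<Rightarrow> dual_vol M K \<sigma> * (causality \<sigma> * (\<alpha> \<sigma> / vol M \<sigma>))
     | BDual e \<Rightarrow> b e)"


section \<open>Discrete Maxwell equations\<close>

text \<open>
  The boundary flux of \<open>*dA\<close> through the boundary dual of \<open>e\<close>: the value for which the
  Euler-Lagrange equation with source \<open>J\<close> holds at the boundary edge \<open>e\<close>.
\<close>

definition bdry_flux :: "mesh \<Rightarrow> cell set \<Rightarrow> dual_form \<Rightarrow> primal_form \<Rightarrow> cell \<Rightarrow> real" where
  "bdry_flux M K J A e =
     (\<Sum>\<sigma>\<in>K. incidence M \<sigma> e * hodge M K (extd M K A) (\<lambda>_. 0) (Dual \<sigma>)) - J (Dual e)"

text \<open>\<open>*dA\<close> as a dual 2-form on \<open>*K\<close>, boundary dual cells included.\<close>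

definition star_d :: "mesh \<Rightarrow> cell set \<Rightarrow> dual_form \<Rightarrow> primal_form \<Rightarrow> dual_form" where
  "star_d M K J A = hodge M K (extd M K A) (bdry_flux M K J A)"

text \<open>\<open>\<langle>L\<^sub>d, K\<rangle>\<close> with \<open>L\<^sub>d = -1/2 dA \<and> *dA + A \<and> J\<close>.\<close>

definition action :: "mesh \<Rightarrow> cell set \<Rightarrow> dual_form \<Rightarrow> primal_form \<Rightarrow> real" where
  "action M K J A = - (1/2) * pairing 2 K (extd M K A) (star_d M K J A) + pairing 1 K A J"

definition euler_lagrange :: "mesh \<Rightarrow> cell set \<Rightarrow> dual_form \<Rightarrow> primal_form \<Rightarrow> bool" where
  "euler_lagrange M K J A \<longleftrightarrow>
     (\<forall>e\<in>kcells 1 K. dual_extd M K (star_d M K J A) e = J (Dual e))"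

text \<open>The linearised equations; they do not depend on the solution, and their source is 0.\<close>

definition first_variation :: "mesh \<Rightarrow> cell set \<Rightarrow> primal_form \<Rightarrow> bool" where
  "first_variation M K \<alpha> \<longleftrightarrow>
     (\<forall>e\<in>kcells 1 K. dual_extd M K (star_d M K (\<lambda>_. 0) \<alpha>) e = 0)"


section \<open>The multisymplectic form\<close>

text \<open>
  Smooth forms on the vector space of discrete 1-forms, with values in boundary 3-forms: the
  first argument is the base point, the others are tangent vectors.
\<close>

type_synonym one_form = "primal_form \<Rightarrow> primal_form \<Rightarrow> bdry_form"
type_synonym two_form = "primal_form \<Rightarrow> primal_form \<Rightarrow> primal_form \<Rightarrow> bdry_form"

definition dir_deriv :: "(primal_form \<Rightarrow> real) \<Rightarrow> primal_form \<Rightarrow> primal_form \<Rightarrow> real" where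
  "dir_deriv F A \<alpha> = deriv (\<lambda>t. F (\<lambda>\<sigma>. A \<sigma> + t * \<alpha> \<sigma>)) 0"

text \<open>
  \<open>d\<theta>(\<alpha>,\<beta>) = \<alpha>(\<theta>(\<beta>)) - \<beta>(\<theta>(\<alpha>)) - \<theta>([\<alpha>,\<beta>])\<close>, with \<open>\<alpha>\<close> and \<open>\<beta>\<close> extended to constant vector
  fields, so that the bracket vanishes.
\<close>

definition smooth_d :: "one_form \<Rightarrow> two_form" where
  "smooth_d \<theta> A \<alpha> \<beta> e =
     dir_deriv (\<lambda>B. \<theta> B \<beta> e) A \<alpha> - dir_deriv (\<lambda>B. \<theta> B \<alpha> e) A \<beta>"

definition cartan_form :: "mesh \<Rightarrow> cell set \<Rightarrow> dual_form \<Rightarrow> one_form" where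
  "cartan_form M K J A \<alpha> = bdry_wedge \<alpha> (star_d M K J A)"

definition multisymplectic_form :: "mesh \<Rightarrow> cell set \<Rightarrow> dual_form \<Rightarrow> two_form" where
  "multisymplectic_form M K J A \<alpha> \<beta> e = - smooth_d (cartan_form M K J) A \<alpha> \<beta> e"


section \<open>Integration by parts and the Euler-Lagrange equations\<close>

lemma incidence_dim: "incidence M \<sigma> \<tau> \<noteq> 0 \<Longrightarrow> aff_dim \<sigma> = aff_dim \<tau> + 1"
  by (auto simp: incidence_def facet_of_def split: if_splits)

lemma bdry_subset: "bdry K \<subseteq> K"
  by (auto simp: bdry_def)

lemma integration_by_parts:
  assumes "finite K"
  shows "pairing 2 K (extd M K \<alpha>) \<eta> =
    (\<Sum>e\<in>kcells 1 K. \<alpha> e * dual_extd M K \<eta> e) + bdry_integral (bdry_wedge \<alpha> \<eta>) K"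
proof -
  have fin: "finite (kcells k K)" for k
    using assms by (simp add: kcells_def)
  have "pairing 2 K (extd M K \<alpha>) \<eta> =
      (\<Sum>\<sigma>\<in>kcells 2 K. \<Sum>e\<in>K. \<alpha> e * (incidence M \<sigma> e * \<eta> (Dual \<sigma>)))"
    by (simp add: pairing_def extd_def sum_distrib_left sum_distrib_right mult_ac)
  also have "\<dots> = (\<Sum>\<sigma>\<in>kcells 2 K. \<Sum>e\<in>kcells 1 K. \<alpha> e * (incidence M \<sigma> e * \<eta> (Dual \<sigma>)))"
    using assms by (intro sum.cong refl sum.mono_neutral_right)
      (auto simp: kcells_def dest: incidence_dim)
  also have "\<dots> = (\<Sum>e\<in>kcells 1 K. \<Sum>\<sigma>\<in>kcells 2 K. \<alpha> e * (incidence M \<sigma> e * \<eta> (Dual \<sigma>)))"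
    by (rule sum.swap)
  also have "\<dots> = (\<Sum>e\<in>kcells 1 K. \<Sum>\<sigma>\<in>K. \<alpha> e * (incidence M \<sigma> e * \<eta> (Dual \<sigma>)))"
    using assms by (intro sum.cong refl sum.mono_neutral_left)
      (auto simp: kcells_def dest: incidence_dim)
  also have "\<dots> = (\<Sum>e\<in>kcells 1 K. \<alpha> e * dual_extd M K \<eta> e
      + (if e \<in> bdry K then \<alpha> e * \<eta> (BDual e) else 0))"
    by (intro sum.cong refl) (simp add: dual_extd_def sum_distrib_left algebra_simps)
  also have "\<dots> = (\<Sum>e\<in>kcells 1 K. \<alpha> e * dual_extd M K \<eta> e)
      + (\<Sum>e\<in>kcells 1 K. if e \<in> bdry K then \<alpha> e * \<eta> (BDual e) else 0)"
    by (rule sum.distrib)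
  also have "(\<Sum>e\<in>kcells 1 K. if e \<in> bdry K then \<alpha> e * \<eta> (BDual e) else 0)
      = bdry_integral (bdry_wedge \<alpha> \<eta>) K"
    unfolding bdry_integral_def bdry_wedge_def using fin bdry_subset[of K]
    by (intro sum.mono_neutral_cong_right) (auto simp: kcells_def)
  finally show ?thesis .
qed

lemma extd_linear:
  "extd M K (\<lambda>\<sigma>. A \<sigma> + t * \<alpha> \<sigma>) \<sigma> = extd M K A \<sigma> + t * extd M K \<alpha> \<sigma>"
  by (simp add: extd_def sum.distrib sum_distrib_left algebra_simps)

lemma star_d_dual:
  "star_d M K J A (Dual \<sigma>) = dual_vol M K \<sigma> * causality \<sigma> / vol M \<sigma> * extd M K A \<sigma>"
  by (simp add: star_d_def hodge_def)

lemma action_has_derivative: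
  assumes "finite K"
  shows "((\<lambda>t. action M K J (\<lambda>\<sigma>. A \<sigma> + t * \<alpha> \<sigma>)) has_real_derivative
    (\<Sum>e\<in>kcells 1 K. \<alpha> e * (J (Dual e) - dual_extd M K (star_d M K J A) e))
     - bdry_integral (bdry_wedge \<alpha> (star_d M K J A)) K) (at 0)"
proof -
  define w where "w \<sigma> = dual_vol M K \<sigma> * causality \<sigma> / vol M \<sigma>" for \<sigma>
  have w: "star_d M K J B (Dual \<sigma>) = w \<sigma> * extd M K B \<sigma>" for B \<sigma>
    by (simp add: star_d_dual w_def)
  have "((\<lambda>t. action M K J (\<lambda>\<sigma>. A \<sigma> + t * \<alpha> \<sigma>)) has_real_derivative
    - pairing 2 K (extd M K \<alpha>) (star_d M K J A) + pairing 1 K \<alpha> J) (at 0)"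
    unfolding action_def pairing_def w extd_linear
    by (auto intro!: derivative_eq_intros sum.cong
        simp: sum_distrib_left sum_negf[symmetric] sum.distrib[symmetric] algebra_simps)
  then show ?thesis
    unfolding integration_by_parts[OF assms]
    by (simp add: pairing_def algebra_simps sum_subtractf)
qed

text \<open>\<open>A\<close> solves the discrete Euler-Lagrange equations iff it is a critical point of the action
  under variations that vanish on \<open>\<partial>K\<close>.\<close>

lemma euler_lagrange_iff_stationary:
  assumes "finite K"
  shows "euler_lagrange M K J A \<longleftrightarrow>
    (\<forall>\<alpha>. (\<forall>e\<in>kcells 1 (bdry K). \<alpha> e = 0) \<longrightarrow>
      ((\<lambda>t. action M K J (\<lambda>\<sigma>. A \<sigma> + t * \<alpha> \<sigma>)) has_real_derivative 0) (at 0))"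
    (is "_ \<longleftrightarrow> ?R")
proof
  assume "euler_lagrange M K J A"
  then have eq: "dual_extd M K (star_d M K J A) e = J (Dual e)" if "e \<in> kcells 1 K" for e
    using that by (simp add: euler_lagrange_def)
  show ?R
  proof (intro allI impI)
    fix \<alpha> :: primal_form
    assume "\<forall>e\<in>kcells 1 (bdry K). \<alpha> e = 0"
    then have "(\<Sum>e\<in>kcells 1 K. \<alpha> e * (J (Dual e) - dual_extd M K (star_d M K J A) e))
        - bdry_integral (bdry_wedge \<alpha> (star_d M K J A)) K = 0"
      by (simp add: eq bdry_integral_def bdry_wedge_def)
    then show "((\<lambda>t. action M K J (\<lambda>\<sigma>. A \<sigma> + t * \<alpha> \<sigma>)) has_real_derivative 0) (at 0)"
      using action_has_derivative[OF assms, of M J A \<alpha>] by simp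
  qed
next
  assume R: ?R
  have "dual_extd M K (star_d M K J A) e = J (Dual e)" if e: "e \<in> kcells 1 K" for e
  proof (cases "e \<in> bdry K")
    case True
    then show ?thesis
      by (simp add: dual_extd_def star_d_def hodge_def bdry_flux_def)
  next
    case False
    define \<alpha> :: primal_form where "\<alpha> x = (if x = e then 1 else 0)" for x
    have 0: "\<alpha> x = 0" if "x \<in> kcells 1 (bdry K)" for x
      using that False by (auto simp: \<alpha>_def kcells_def)
    have "(\<Sum>x\<in>kcells 1 K. \<alpha> x * (J (Dual x) - dual_extd M K (star_d M K J A) x))
        - bdry_integral (bdry_wedge \<alpha> (star_d M K J A)) K = 0"
      using R 0 by (intro DERIV_unique[OF action_has_derivative[OF assms]]) blast
    moreover have "bdry_integral (bdry_wedge \<alpha> (star_d M K J A)) K = 0"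
      by (simp add: bdry_integral_def bdry_wedge_def 0)
    moreover have "finite (kcells 1 K)"
      using assms by (simp add: kcells_def)
    ultimately show ?thesis
      using e by (simp add: \<alpha>_def of_bool_def[symmetric] if_distrib[where f = "\<lambda>x. x * _"] 
          sum.delta cong: if_cong)
  qed
  then show "euler_lagrange M K J A"
    by (simp add: euler_lagrange_def)
qed

text \<open>First variations are exactly the tangent vectors to the affine space of solutions.\<close>

lemma first_variation_iff_tangent:
  assumes "finite K" and "euler_lagrange M K J A"
  shows "first_variation M K \<alpha> \<longleftrightarrow> (\<forall>t. euler_lagrange M K J (\<lambda>\<sigma>. A \<sigma> + t * \<alpha> \<sigma>))"
proof -
  have *: "star_d M K J (\<lambda>\<sigma>. A \<sigma> + t * \<alpha> \<sigma>) c
      = star_d M K J A c + t * star_d M K (\<lambda>_. 0) \<alpha> c" for c t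
    by (simp add: star_d_def hodge_def bdry_flux_def extd_linear sum.distrib sum_distrib_left
        algebra_simps add_divide_distrib split: dual_cell.split)
  have "dual_extd M K (star_d M K J (\<lambda>\<sigma>. A \<sigma> + t * \<alpha> \<sigma>)) e
      = dual_extd M K (star_d M K J A) e + t * dual_extd M K (star_d M K (\<lambda>_. 0) \<alpha>) e" for e t
    by (simp add: dual_extd_def * sum.distrib sum_distrib_left algebra_simps)
  then show ?thesis
    using assms(2) by (fastforce simp: euler_lagrange_def first_variation_def dest: spec[of _ 1])
qed

end

theory Submission
  imports Defs
begin

text \<open>
  The theorem is Green's second identity (reciprocity) for the operator \<open>d*d\<close>.  The Cartan form
  \<open>\<alpha> \<and> *dA\<close> is affine in \<open>A\<close>, so minus its smooth exterior derivative is the constant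
  antisymmetrised product \<open>\<alpha> \<and> *d\<beta> - \<beta> \<and> *d\<alpha>\<close> (\<open>multisymplectic_form_eq\<close>).  If \<open>\<beta>\<close> is a first
  variation, then \<open>d*d\<beta> = 0\<close>, and summation by parts turns the boundary term into a bulk term,
  \<open>\<langle>\<alpha> \<and> *d\<beta>, \<partial>K\<rangle> = \<langle>d\<alpha> \<and> *d\<beta>, K\<rangle>\<close> (\<open>bdry_integral_first_variation\<close>).  The bulk term is symmetric in
  \<open>\<alpha>\<close> and \<open>\<beta>\<close> because the Hodge star is diagonal (\<open>pairing_star_d_commute\<close>), so antisymmetrising
  it gives 0.
\<close>

text \<open>The source enters \<open>*dA\<close> only as an additive constant in the boundary flux; hence the linear part
  is \<open>*d\<alpha>\<close> for source 0, the same dual form as in the linearised equations.\<close>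

lemma star_d_affine:
  "star_d M K J (\<lambda>\<sigma>. A \<sigma> + t * \<alpha> \<sigma>) c = star_d M K J A c + t * star_d M K (\<lambda>_. 0) \<alpha> c"
  by (simp add: star_d_def hodge_def bdry_flux_def extd_linear sum.distrib sum_distrib_left
      algebra_simps add_divide_distrib split: dual_cell.split)

lemma dir_deriv_cartan_form:
  "dir_deriv (\<lambda>B. cartan_form M K J B \<beta> e) A \<alpha> = bdry_wedge \<beta> (star_d M K (\<lambda>_. 0) \<alpha>) e"
  unfolding dir_deriv_def cartan_form_def bdry_wedge_def star_d_affine
  by (rule DERIV_imp_deriv) (auto intro!: derivative_eq_intros)

lemma multisymplectic_form_eq:
  "multisymplectic_form M K J A \<alpha> \<beta> e =
     bdry_wedge \<alpha> (star_d M K (\<lambda>_. 0) \<beta>) e - bdry_wedge \<beta> (star_d M K (\<lambda>_. 0) \<alpha>) e"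
  by (simp add: multisymplectic_form_def smooth_d_def dir_deriv_cartan_form)

text \<open>Both sides weight \<open>d\<alpha> d\<beta>\<close> on each 2-cell by the same Hodge coefficient.\<close>

lemma pairing_star_d_commute:
  "pairing 2 K (extd M K \<alpha>) (star_d M K J \<beta>) = pairing 2 K (extd M K \<beta>) (star_d M K J' \<alpha>)"
  by (simp add: pairing_def star_d_dual mult_ac)

text \<open>The interior term of the integration by parts is \<open>\<langle>\<alpha> \<and> d*d\<beta>, K\<rangle>\<close>, which the linearised
  equations annihilate.\<close>

lemma bdry_integral_first_variation:
  assumes "finite K" and "first_variation M K \<beta>"
  shows "bdry_integral (bdry_wedge \<alpha> (star_d M K (\<lambda>_. 0) \<beta>)) K =
    pairing 2 K (extd M K \<alpha>) (star_d M K (\<lambda>_. 0) \<beta>)"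
  using assms(2) by (simp add: integration_by_parts[OF assms(1)] first_variation_def)

theorem theorem5p2:
  fixes M :: mesh and K :: "cell set" and J :: dual_form and A \<alpha> \<beta> :: primal_form
  assumes "spacetime_mesh M"
    and "finite_subcomplex M K"
    and "\<And>\<sigma>. \<sigma> \<in> kcells 2 K \<Longrightarrow> vol M \<sigma> \<noteq> 0 \<and> dual_vol M K \<sigma> \<noteq> 0"
    and "euler_lagrange M K J A"
    and "first_variation M K \<alpha>" and "first_variation M K \<beta>"
  shows "bdry_integral (multisymplectic_form M K J A \<alpha> \<beta>) K = 0"
proof -
  have fin: "finite K"
    using assms(2) by (simp add: finite_subcomplex_def)
  have "bdry_integral (multisymplectic_form M K J A \<alpha> \<beta>) K =
      bdry_integral (bdry_wedge \<alpha> (star_d M K (\<lambda>_. 0) \<beta>)) K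
      - bdry_integral (bdry_wedge \<beta> (star_d M K (\<lambda>_. 0) \<alpha>)) K"
    by (simp add: bdry_integral_def multisymplectic_form_eq sum_subtractf)
  also have "\<dots> = pairing 2 K (extd M K \<alpha>) (star_d M K (\<lambda>_. 0) \<beta>)
      - pairing 2 K (extd M K \<beta>) (star_d M K (\<lambda>_. 0) \<alpha>)"
    by (simp only: bdry_integral_first_variation[OF fin assms(5)]
        bdry_integral_first_variation[OF fin assms(6)])
  also have "\<dots> = 0"
    using pairing_star_d_commute[of K M \<alpha> "\<lambda>_. 0" \<beta> "\<lambda>_. 0"] by simp
  finally show ?thesis .
qed

end
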